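(* Let $n, m \in \mathbb{N}$ and let $s_1, \dots, s_n$ be positive integers with $s_i \le 2^m$ for all $i$. Let $p_1 < \dots < p_q$ be all the distinct primes dividing at least one of the $s_i$, and write $s_i = \prod_{k=1}^q p_k^{\alpha_{i,k}}$ with $\alpha_{i,k} \in \mathbb{Z}_{\ge 0}$. For each $k \in \{1,\dots,q\}$ put $T_k = \frac{1}{2}\sum_{i=1}^n \alpha_{i,k}$, and assume that $T_k$ is an integer for every $k$. Define $$\hat{s}_i = \sum_{k=1}^q \alpha_{i,k}\, k\, (nm)^{k-1} \quad (1 \le i \le n), \qquad \hat{T} = \sum_{k=1}^q T_k\, k\, (nm)^{k-1}.$$ Then there exists a set $\mathcal{C} \subseteq \{1,\dots,n\}$ with $$\prod_{i \in \mathcal{C}} s_i = \prod_{i \in \{1,\dots,n\}\setminus \mathcal{C}} s_i$$ if and only if there exists $x = (x_1,\dots,x_n) \in \{0,1\}^n$ with $\sum_{i=1}^n x_i \hat{s}_i = \hat{T}$.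
   Context: $\mathbb{N}$ denotes the positive integers. Empty products equal $1$ and empty sums equal $0$. The first condition is the Product Partition Problem (PPP) for $s_1,\dots,s_n$; the second is the Subset Sum Problem (SSP) for the numbers $\hat{s}_1,\dots,\hat{s}_n$ with target $\hat{T}$. *)

theory Defs
  imports Complex_Main "HOL-Computational_Algebra.Primes"
begin

end

theory Submission
  imports Defs
begin

text \<open>
  Both conditions on a set C of indices say that, for every k, the exponents of the k-th prime
  over C and over its complement have equal sums. For products this is unique factorisation.
  For subset sums, let e(k) be the difference of the two exponent sums. Since s(i) is at most
  2^m, the exponents of s(i) add up to at most m, hence the |e(k)| add up to at most B = nm.
  If e(K) were the last nonzero difference, the terms below K would contribute at most
  (K-1) B^(K-2) B < K B^(K-1) to the sum of the e(k) k B^(k-1), which therefore would not vanish.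
\<close>

text \<open>Single digits may reach \<open>B\<close> in absolute value, so plain
  base-\<open>B\<close> uniqueness would fail: \<open>B\<close> at one place cancels -1 at the next.
  The extra weight \<open>k\<close> supplies the missing slack. Bounding the total of the absolute
  values, not each one, gives a hypothesis that survives removal of the top digit, so induction on
  \<open>q\<close> applies.\<close>

lemma weighted_digits_eq_0:
  fixes e :: "nat \<Rightarrow> int" and B q :: nat
  assumes "B \<ge> 1" "(\<Sum>k=1..q. \<bar>e k\<bar>) \<le> int B"
    and "(\<Sum>k=1..q. e k * int k * int B ^ (k - 1)) = 0"
    and "k \<in> {1..q}"
  shows "e k = 0"
  using assms(2-)
proof (induction q arbitrary: k)
  case 0
  then show ?case by simp
next
  case (Suc q)
  have bound: "(\<Sum>k=1..q. \<bar>e k\<bar>) \<le> int B"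
    using Suc.prems(1) by simp
  let ?S = "\<Sum>k=1..q. e k * int k * int B ^ (k - 1)"
  have "\<bar>?S\<bar> \<le> (\<Sum>k=1..q. \<bar>e k * int k * int B ^ (k - 1)\<bar>)"
    by (rule sum_abs)
  also have "\<dots> \<le> (\<Sum>k=1..q. \<bar>e k\<bar> * (int q * int B ^ (q - 1)))"
  proof (rule sum_mono)
    fix k assume "k \<in> {1..q}"
    then have "int k * int B ^ (k - 1) \<le> int q * int B ^ (q - 1)"
      using \<open>B \<ge> 1\<close> by (intro mult_mono power_increasing) auto
    then have "\<bar>e k\<bar> * (int k * int B ^ (k - 1)) \<le> \<bar>e k\<bar> * (int q * int B ^ (q - 1))"
      by (rule mult_left_mono) simp
    then show "\<bar>e k * int k * int B ^ (k - 1)\<bar> \<le> \<bar>e k\<bar> * (int q * int B ^ (q - 1))"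
      by (simp add: abs_mult mult.assoc)
  qed
  also have "\<dots> = (\<Sum>k=1..q. \<bar>e k\<bar>) * (int q * int B ^ (q - 1))"
    by (simp add: sum_distrib_right)
  also have "\<dots> \<le> int B * (int q * int B ^ (q - 1))"
    using bound by (rule mult_right_mono) simp
  \<comment> \<open>For \<open>q = 0\<close> the truncated exponent \<open>q - 1\<close> is 0, but
    the factor \<open>int q\<close> makes both sides vanish.\<close>
  also have "\<dots> = int q * int B ^ q"
    by (cases q) simp_all
  \<comment> \<open>Strictness comes solely from the weight growing from \<open>q\<close> to
    \<open>Suc q\<close>, as \<open>B ^ q\<close> is positive.\<close>
  also have "\<dots> < int (Suc q) * int B ^ q"
    using \<open>B \<ge> 1\<close> by (simp add: distrib_right)
  finally have S: "\<bar>?S\<bar> < int (Suc q) * int B ^ q" .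
  have eq: "?S = - (e (Suc q) * (int (Suc q) * int B ^ q))"
    using Suc.prems(2) by (simp add: mult.assoc)
  have "e (Suc q) = 0"
  proof (rule ccontr)
    assume "e (Suc q) \<noteq> 0"
    \<comment> \<open>A nonzero integer has absolute value at least 1, so the top term is at least
      its own weight, too large for the lower terms to cancel.\<close>
    then have "1 * (int (Suc q) * int B ^ q) \<le> \<bar>e (Suc q)\<bar> * (int (Suc q) * int B ^ q)"
      by (intro mult_right_mono) auto
    then have "int (Suc q) * int B ^ q \<le> \<bar>?S\<bar>"
      unfolding eq by (simp add: abs_mult)
    then show False using S by simp
  qed
  moreover from this have "?S = 0" using eq by simp
  ultimately show ?case
    using Suc.IH[OF bound] Suc.prems(3) by (cases "k = Suc q") auto
qed

lemma prime_powers_prod_eq_iff: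
  fixes p a b :: "'a \<Rightarrow> nat"
  assumes "finite K" "inj_on p K" and prime: "\<And>k. k \<in> K \<Longrightarrow> prime (p k)"
  shows "(\<Prod>k\<in>K. p k ^ a k) = (\<Prod>k\<in>K. p k ^ b k) \<longleftrightarrow> (\<forall>k\<in>K. a k = b k)"
proof
  assume eq: "(\<Prod>k\<in>K. p k ^ a k) = (\<Prod>k\<in>K. p k ^ b k)"
  have mult: "multiplicity (p k) (\<Prod>k\<in>K. p k ^ c k) = c k" if "k \<in> K" for k and c :: "'a \<Rightarrow> nat"
  proof -
    \<comment> \<open>The multiplicity rule expects a product indexed by the primes themselves;
      injectivity of \<open>p\<close> lets \<open>inv_into\<close> recover the index of each
      prime.\<close>
    have prod: "(\<Prod>k\<in>K. p k ^ c k) = (\<Prod>r\<in>p ` K. r ^ c (inv_into K p r))"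
      using assms(2) by (simp add: prod.reindex)
    have "multiplicity (p k) (\<Prod>k\<in>K. p k ^ c k) = (if p k \<in> p ` K then c (inv_into K p (p k)) else 0)"
      unfolding prod using assms(1) prime that by (intro multiplicity_prod_prime_powers) auto
    then show ?thesis
      using assms(2) that by simp
  qed
  show "\<forall>k\<in>K. a k = b k"
  proof
    fix k assume "k \<in> K"
    show "a k = b k"
      using mult[OF \<open>k \<in> K\<close>, of a] mult[OF \<open>k \<in> K\<close>, of b] unfolding eq by (rule trans[OF sym])
  qed
qed simp

text \<open>Replacing every base by 2 can only shrink the product, and powers of 2 compare as their
  exponents do.\<close>

lemma sum_exponents_le:
  fixes p a :: "'a \<Rightarrow> nat"
  assumes "\<And>k. k \<in> K \<Longrightarrow> p k \<ge> 2" "(\<Prod>k\<in>K. p k ^ a k) \<le> 2 ^ m"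
  shows "(\<Sum>k\<in>K. a k) \<le> m"
proof -
  have "2 ^ (\<Sum>k\<in>K. a k) = (\<Prod>k\<in>K. 2 ^ a k :: nat)"
    by (rule power_sum)
  also have "\<dots> \<le> (\<Prod>k\<in>K. p k ^ a k)"
    using assms(1) by (intro prod_mono) (auto intro: power_mono)
  also note assms(2)
  finally show ?thesis by simp
qed

theorem theorem2p7:
  fixes n m q :: nat
    and s p :: "nat \<Rightarrow> nat"
    and \<alpha> :: "nat \<Rightarrow> nat \<Rightarrow> nat"
    and T :: "nat \<Rightarrow> real"
    and s_hat :: "nat \<Rightarrow> nat"
    and T_hat :: real
  assumes "n \<ge> 1" and "m \<ge> 1"
    and "\<And>i. i \<in> {1..n} \<Longrightarrow> 0 < s i \<and> s i \<le> 2 ^ m"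
    and "strict_mono_on {1..q} p"
    and "p ` {1..q} = {r. prime r \<and> (\<exists>i\<in>{1..n}. r dvd s i)}"
    and "\<And>i. i \<in> {1..n} \<Longrightarrow> s i = (\<Prod>k=1..q. p k ^ \<alpha> i k)"
    and "\<And>k. k \<in> {1..q} \<Longrightarrow> T k = 1 / 2 * (\<Sum>i=1..n. real (\<alpha> i k))"
    and "\<And>k. k \<in> {1..q} \<Longrightarrow> T k \<in> \<int>"
    and "\<And>i. i \<in> {1..n} \<Longrightarrow> s_hat i = (\<Sum>k=1..q. \<alpha> i k * k * (n * m) ^ (k - 1))"
    and "T_hat = (\<Sum>k=1..q. T k * real k * real (n * m) ^ (k - 1))"
  shows "(\<exists>C. C \<subseteq> {1..n} \<and> (\<Prod>i\<in>C. s i) = (\<Prod>i\<in>{1..n} - C. s i)) \<longleftrightarrow>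
         (\<exists>x :: nat \<Rightarrow> nat. (\<forall>i\<in>{1..n}. x i \<in> {0, 1}) \<and>
            real (\<Sum>i=1..n. x i * s_hat i) = T_hat)"
proof -
  define B where "B = n * m"
  have "B \<ge> 1" using assms(1,2) by (simp add: B_def)
  have inj: "inj_on p {1..q}"
    using assms(4) by (rule strict_mono_on_imp_inj_on)
  have prime: "prime (p k)" if "k \<in> {1..q}" for k
    using assms(5) that by blast
  define bal where "bal C \<longleftrightarrow> (\<forall>k\<in>{1..q}. (\<Sum>i\<in>C. \<alpha> i k) = (\<Sum>i\<in>{1..n} - C. \<alpha> i k))" for C
  have total: "(\<Sum>i=1..n. f i) = (\<Sum>i\<in>C. f i) + (\<Sum>i\<in>{1..n} - C. f i)"
    if "C \<subseteq> {1..n}" for C and f :: "nat \<Rightarrow> nat"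
    using sum.subset_diff[OF that, of f] by simp
  have products: "(\<Prod>i\<in>C. s i) = (\<Prod>i\<in>{1..n} - C. s i) \<longleftrightarrow> bal C" if "C \<subseteq> {1..n}" for C
  proof -
    have prod_s: "(\<Prod>i\<in>D. s i) = (\<Prod>k=1..q. p k ^ (\<Sum>i\<in>D. \<alpha> i k))" if "D \<subseteq> {1..n}" for D
    proof -
      have "(\<Prod>i\<in>D. s i) = (\<Prod>i\<in>D. \<Prod>k=1..q. p k ^ \<alpha> i k)"
        using that assms(6) by (intro prod.cong) auto
      also have "\<dots> = (\<Prod>k=1..q. \<Prod>i\<in>D. p k ^ \<alpha> i k)"
        by (rule prod.swap)
      finally show ?thesis by (simp add: power_sum)
    qed
    show ?thesis
      unfolding prod_s[OF that] prod_s[OF Diff_subset] bal_def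
      by (rule prime_powers_prod_eq_iff) (use inj prime in auto)
  qed
  have sums: "real (\<Sum>i\<in>C. s_hat i) = T_hat \<longleftrightarrow> bal C" if C: "C \<subseteq> {1..n}" for C
  proof -
    define e where "e k = int (\<Sum>i\<in>C. \<alpha> i k) - int (\<Sum>i\<in>{1..n} - C. \<alpha> i k)" for k
    have "(\<Sum>i\<in>C. s_hat i) = (\<Sum>i\<in>C. \<Sum>k=1..q. \<alpha> i k * k * B ^ (k - 1))"
      using C assms(9) by (intro sum.cong) (auto simp: B_def)
    also have "\<dots> = (\<Sum>k=1..q. \<Sum>i\<in>C. \<alpha> i k * k * B ^ (k - 1))"
      by (rule sum.swap)
    finally have "real (\<Sum>i\<in>C. s_hat i)
        = (\<Sum>k=1..q. real (\<Sum>i\<in>C. \<alpha> i k) * real k * real B ^ (k - 1))"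
      by (simp add: sum_distrib_right)
    moreover have "T_hat = (\<Sum>k=1..q. T k * real k * real B ^ (k - 1))"
      using assms(10) by (simp add: B_def)
    \<comment> \<open>Doubling clears the factor 1/2 in \<open>T k\<close>. By \<open>total\<close>,
      \<open>2 * T k\<close> is the exponent sum over \<open>C\<close> plus that over the
      complement, so each coefficient becomes the integer \<open>e k\<close>.\<close>
    ultimately have "2 * (real (\<Sum>i\<in>C. s_hat i) - T_hat)
        = (\<Sum>k=1..q. 2 * (real (\<Sum>i\<in>C. \<alpha> i k) - T k) * real k * real B ^ (k - 1))"
      by (simp add: sum_distrib_left sum_subtractf algebra_simps)
    also have "\<dots> = (\<Sum>k=1..q. real_of_int (e k) * real k * real B ^ (k - 1))"
    proof (rule sum.cong)
      fix k assume "k \<in> {1..q}"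
      then have "2 * T k = real (\<Sum>i=1..n. \<alpha> i k)"
        using assms(7)[of k] by simp
      then have "2 * (real (\<Sum>i\<in>C. \<alpha> i k) - T k) = real_of_int (e k)"
        unfolding e_def total[OF C] by simp
      then show "2 * (real (\<Sum>i\<in>C. \<alpha> i k) - T k) * real k * real B ^ (k - 1)
          = real_of_int (e k) * real k * real B ^ (k - 1)"
        by simp
    qed simp
    also have "\<dots> = real_of_int (\<Sum>k=1..q. e k * int k * int B ^ (k - 1))"
      by simp
    finally have diff: "2 * (real (\<Sum>i\<in>C. s_hat i) - T_hat)
        = real_of_int (\<Sum>k=1..q. e k * int k * int B ^ (k - 1))" .
    \<comment> \<open>A difference of two naturals is at most their sum in absolute value. Swapping
      the summations then groups the exponents by \<open>i\<close>, where each \<open>s i\<close>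
      contributes at most \<open>m\<close>.\<close>
    have "(\<Sum>k=1..q. \<bar>e k\<bar>) \<le> (\<Sum>k=1..q. int (\<Sum>i=1..n. \<alpha> i k))"
      unfolding e_def total[OF C] by (intro sum_mono) linarith
    also have "\<dots> = int (\<Sum>i=1..n. \<Sum>k=1..q. \<alpha> i k)"
      by (subst sum.swap) simp
    also have "(\<Sum>i=1..n. \<Sum>k=1..q. \<alpha> i k) \<le> (\<Sum>i=1..n. m)"
    proof (rule sum_mono)
      fix i assume "i \<in> {1..n}"
      then show "(\<Sum>k=1..q. \<alpha> i k) \<le> m"
        using assms(3)[of i] assms(6)[of i] prime
        by (intro sum_exponents_le[of _ p]) (auto intro: prime_ge_2_nat)
    qed
    also have "int (\<Sum>i=1..n. m) = int B"
      by (simp add: B_def)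
    finally have bound: "(\<Sum>k=1..q. \<bar>e k\<bar>) \<le> int B" by simp
    have "real (\<Sum>i\<in>C. s_hat i) = T_hat \<longleftrightarrow>
        (\<Sum>k=1..q. e k * int k * int B ^ (k - 1)) = 0"
      \<comment> \<open>The integer equation is lifted to the reals so that \<open>diff\<close>,
        read backwards, turns it into the vanishing of twice the gap to the target.\<close>
      unfolding of_int_eq_0_iff[where 'a = real, symmetric] diff[symmetric] by simp
    also have "\<dots> \<longleftrightarrow> (\<forall>k\<in>{1..q}. e k = 0)"
      using weighted_digits_eq_0[OF \<open>B \<ge> 1\<close> bound] by auto
    also have "\<dots> \<longleftrightarrow> bal C"
      unfolding bal_def e_def by (simp only: right_minus_eq of_nat_eq_iff)
    finally show ?thesis .
  qed
  have "(\<exists>C\<subseteq>{1..n}. (\<Prod>i\<in>C. s i) = (\<Prod>i\<in>{1..n} - C. s i)) \<longleftrightarrow>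
      (\<exists>C\<subseteq>{1..n}. real (\<Sum>i\<in>C. s_hat i) = T_hat)"
    using products sums by (intro arg_cong[where f = Ex] ext conj_cong refl) simp
  \<comment> \<open>Subsets correspond to 0/1 vectors: \<open>x\<close> is the indicator of
    \<open>C\<close>, and conversely \<open>C\<close> collects the indices where \<open>x\<close> is
    1.\<close>
  also have "\<dots> \<longleftrightarrow>
      (\<exists>x :: nat \<Rightarrow> nat. (\<forall>i\<in>{1..n}. x i \<in> {0, 1}) \<and> real (\<Sum>i=1..n. x i * s_hat i) = T_hat)"
    (is "?subset \<longleftrightarrow> ?vector")
  proof
    assume ?subset
    then obtain C where C: "C \<subseteq> {1..n}" "real (\<Sum>i\<in>C. s_hat i) = T_hat" by blast
    have "(\<Sum>i=1..n. of_bool (i \<in> C) * s_hat i) = (\<Sum>i\<in>C. s_hat i)"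
      using C(1) by (intro sum.mono_neutral_cong_right) auto
    then show ?vector
      using C(2) by (intro exI[of _ "\<lambda>i. of_bool (i \<in> C)"]) simp
  next
    assume ?vector
    then obtain x :: "nat \<Rightarrow> nat" where x: "\<forall>i\<in>{1..n}. x i \<in> {0, 1}"
      and eq: "real (\<Sum>i=1..n. x i * s_hat i) = T_hat" by blast
    have "(\<Sum>i=1..n. x i * s_hat i) = (\<Sum>i\<in>{i\<in>{1..n}. x i = 1}. s_hat i)"
      using x by (intro sum.mono_neutral_cong_right) auto
    then show ?subset
      using eq by (intro exI[of _ "{i\<in>{1..n}. x i = 1}"]) auto
  qed
  finally show ?thesis .
qed

end
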